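(* Let $R$ be a commutative Noetherian ring and let $M$ be a finitely generated $R$-module such that the trace ideal $\tau_M(R)$ has positive grade. Then there are isomorphisms of $R$-algebras $$\operatorname{End}_R(\tau_{M^*}(R)) \cong \operatorname{End}_R(\tau_M(R)) \cong Z(\operatorname{End}_R(M^* )).$$
   Context: For an $R$-module $N$ put $N^* = \operatorname{Hom}_R(N,R)$. The trace ideal of $N$ is $\tau_N(R) = \sum_{\alpha\in N^*}\alpha(N)\subseteq R$. The grade of an ideal $I$ of a Noetherian ring is the common length of the maximal $R$-regular sequences contained in $I$ (infinite if $I=R$); $I$ has positive grade iff it contains a nonzerodivisor of $R$. $Z(S)$ denotes the center of a ring $S$. *)

theory Defs
  imports
    "HOL-Algebra.Module"
    "HOL-Algebra.QuotRing"
    "HOL-Algebra.Ring_Divisibility"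
    "HOL-Library.Extended_Nat"
begin

text \<open>
  An \<open>R\<close>-algebra that need not be commutative is represented by a record of type
  \<open>module\<close> whose ring fields carry the multiplication. For a mere module the
  fields \<open>mult\<close> and \<open>one\<close> have no significance.
\<close>

subsection \<open>Modules\<close>

definition ring_module :: "('a, 'm) ring_scheme \<Rightarrow> ('a, 'a) module" where
  "ring_module R =
    \<lparr>carrier = carrier R, mult = mult R, one = one R, zero = zero R, add = add R,
     smult = mult R\<rparr>"

definition fin_gen_module :: "('a, 'm) ring_scheme \<Rightarrow> ('a, 'b, 'n) module_scheme \<Rightarrow> bool" where
  "fin_gen_module R M \<longleftrightarrow>
    (\<exists>A. finite A \<and> A \<subseteq> carrier M \<and>
      (\<forall>x \<in> carrier M. \<exists>c \<in> A \<rightarrow> carrier R. x = (\<Oplus>\<^bsub>M\<^esub>a\<in>A. c a \<odot>\<^bsub>M\<^esub> a)))"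

text \<open>
  Linear maps are taken to be \<open>undefined\<close> outside the carrier of the domain, so that equality
  of functions is equality of maps.
\<close>

definition linear_maps ::
  "('a, 'm) ring_scheme \<Rightarrow> ('a, 'b, 'n) module_scheme \<Rightarrow> ('a, 'c, 'k) module_scheme \<Rightarrow>
    ('b \<Rightarrow> 'c) set" where
  "linear_maps R N P =
    {f \<in> carrier N \<rightarrow>\<^sub>E carrier P.
      (\<forall>x \<in> carrier N. \<forall>y \<in> carrier N. f (x \<oplus>\<^bsub>N\<^esub> y) = f x \<oplus>\<^bsub>P\<^esub> f y) \<and>
      (\<forall>r \<in> carrier R. \<forall>x \<in> carrier N. f (r \<odot>\<^bsub>N\<^esub> x) = r \<odot>\<^bsub>P\<^esub> f x)}"

definition Hom_module ::
  "('a, 'm) ring_scheme \<Rightarrow> ('a, 'b, 'n) module_scheme \<Rightarrow> ('a, 'c, 'k) module_scheme \<Rightarrow>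
    ('a, 'b \<Rightarrow> 'c) module" where
  "Hom_module R N P =
    \<lparr>carrier = linear_maps R N P,
     mult = undefined,
     one = undefined,
     zero = (\<lambda>x \<in> carrier N. \<zero>\<^bsub>P\<^esub>),
     add = (\<lambda>f g. \<lambda>x \<in> carrier N. f x \<oplus>\<^bsub>P\<^esub> g x),
     smult = (\<lambda>r f. \<lambda>x \<in> carrier N. r \<odot>\<^bsub>P\<^esub> f x)\<rparr>"

definition dual_module ::
  "('a, 'm) ring_scheme \<Rightarrow> ('a, 'b, 'n) module_scheme \<Rightarrow> ('a, 'b \<Rightarrow> 'a) module" where
  "dual_module R N = Hom_module R N (ring_module R)"

definition End_algebra ::
  "('a, 'm) ring_scheme \<Rightarrow> ('a, 'b, 'n) module_scheme \<Rightarrow> ('a, 'b \<Rightarrow> 'b) module" where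
  "End_algebra R N =
    (Hom_module R N N)
      \<lparr>mult := (\<lambda>f g. compose (carrier N) f g), one := (\<lambda>x \<in> carrier N. x)\<rparr>"

text \<open>
  The sum of the submodules \<open>\<alpha>(N)\<close> of \<open>R\<close>: all finite sums of elements taken from them.
\<close>

definition trace_ideal :: "('a, 'm) ring_scheme \<Rightarrow> ('a, 'b, 'n) module_scheme \<Rightarrow> 'a set" where
  "trace_ideal R N =
    {\<Oplus>\<^bsub>R\<^esub>\<alpha>\<in>A. s \<alpha> | A s.
      finite A \<and> A \<subseteq> carrier (dual_module R N) \<and> s \<in> (\<Pi> \<alpha>\<in>A. \<alpha> ` carrier N)}"

definition trace_module ::
  "('a, 'm) ring_scheme \<Rightarrow> ('a, 'b, 'n) module_scheme \<Rightarrow> ('a, 'a) module" where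
  "trace_module R N = (ring_module R)\<lparr>carrier := trace_ideal R N\<rparr>"


subsection \<open>Centers and isomorphisms of algebras\<close>

definition ring_center :: "('a, 'm) ring_scheme \<Rightarrow> ('a, 'm) ring_scheme" where
  "ring_center S =
    S\<lparr>carrier := {z \<in> carrier S. \<forall>x \<in> carrier S. z \<otimes>\<^bsub>S\<^esub> x = x \<otimes>\<^bsub>S\<^esub> z}\<rparr>"

definition alg_iso ::
  "('a, 'm) ring_scheme \<Rightarrow> ('a, 'b, 'n) module_scheme \<Rightarrow> ('a, 'c, 'k) module_scheme \<Rightarrow>
    ('b \<Rightarrow> 'c) set" where
  "alg_iso R S T =
    {h \<in> ring_iso S T.
      \<forall>r \<in> carrier R. \<forall>x \<in> carrier S. h (r \<odot>\<^bsub>S\<^esub> x) = r \<odot>\<^bsub>T\<^esub> h x}"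

definition is_alg_iso ::
  "('a, 'm) ring_scheme \<Rightarrow> ('a, 'b, 'n) module_scheme \<Rightarrow> ('a, 'c, 'k) module_scheme \<Rightarrow>
    bool" where
  "is_alg_iso R S T \<longleftrightarrow> alg_iso R S T \<noteq> {}"


subsection \<open>Grade\<close>

definition nonzerodivisor :: "('a, 'm) ring_scheme \<Rightarrow> 'a \<Rightarrow> bool" where
  "nonzerodivisor R x \<longleftrightarrow>
    x \<in> carrier R \<and> (\<forall>y \<in> carrier R. x \<otimes>\<^bsub>R\<^esub> y = \<zero>\<^bsub>R\<^esub> \<longrightarrow> y = \<zero>\<^bsub>R\<^esub>)"

definition regular_sequence :: "('a, 'm) ring_scheme \<Rightarrow> 'a list \<Rightarrow> bool" where
  "regular_sequence R xs \<longleftrightarrow>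
    set xs \<subseteq> carrier R \<and>
    (\<forall>i < length xs.
      nonzerodivisor (R Quot (Idl\<^bsub>R\<^esub> (set (take i xs)))) (Idl\<^bsub>R\<^esub> (set (take i xs)) +>\<^bsub>R\<^esub> xs ! i)) \<and>
    Idl\<^bsub>R\<^esub> (set xs) \<noteq> carrier R"

definition maximal_regular_sequence :: "('a, 'm) ring_scheme \<Rightarrow> 'a set \<Rightarrow> 'a list \<Rightarrow> bool" where
  "maximal_regular_sequence R I xs \<longleftrightarrow>
    regular_sequence R xs \<and> set xs \<subseteq> I \<and> (\<forall>x \<in> I. \<not> regular_sequence R (xs @ [x]))"

text \<open>
  The lengths of the maximal regular sequences in a proper ideal of a Noetherian ring form a
  singleton, by a theorem of Rees. For other rings the value of \<open>grade\<close> has no significance.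
\<close>

definition grade :: "('a, 'm) ring_scheme \<Rightarrow> 'a set \<Rightarrow> enat" where
  "grade R I =
    (if I = carrier R then \<infinity>
     else enat (THE n. length ` {xs. maximal_regular_sequence R I xs} = {n}))"

end

theory Submission
  imports Defs
begin

text \<open>
  Let \<open>x\<close> be a nonzerodivisor in \<open>I = \<tau>\<^sub>M(R)\<close>. Every linear map \<open>f\<close> on \<open>I\<close> satisfies
  \<open>x f(i) = f(x) i\<close>, so it is multiplication by the fraction \<open>f(x)/x\<close>; conversely a fraction
  \<open>c/x\<close> gives an endomorphism of an ideal \<open>J\<close> as soon as \<open>c J \<subseteq> x J\<close>. Restriction from
  \<open>\<tau>\<^bsub>M*\<^esub>(R)\<close> to \<open>I\<close> and postcomposition \<open>\<alpha> \<mapsto> f \<circ> \<alpha>\<close> on \<open>M*\<close> are therefore injective, and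
  surjectivity only requires checking \<open>c J \<subseteq> x J\<close> on generators. For a central \<open>Z\<close>, commutation with
  the rank one maps \<open>\<alpha> \<mapsto> \<alpha>(m) \<beta>\<close> yields \<open>\<alpha>(m) Z(\<beta>) = (Z \<alpha>)(m) \<beta>\<close>, which shows
  that \<open>Z\<close> is multiplication by such a fraction.
\<close>

section \<open>Linear maps, Hom modules and duals\<close>

lemma ring_module_simps [simp]:
  "carrier (ring_module R) = carrier R" "add (ring_module R) = add R"
  "zero (ring_module R) = zero R" "smult (ring_module R) = mult R"
  by (simp_all add: ring_module_def)

lemma Hom_module_simps [simp]:
  "carrier (Hom_module R N P) = linear_maps R N P"
  "zero (Hom_module R N P) = (\<lambda>x \<in> carrier N. \<zero>\<^bsub>P\<^esub>)"
  "add (Hom_module R N P) = (\<lambda>f g. \<lambda>x \<in> carrier N. f x \<oplus>\<^bsub>P\<^esub> g x)"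
  "smult (Hom_module R N P) = (\<lambda>r f. \<lambda>x \<in> carrier N. r \<odot>\<^bsub>P\<^esub> f x)"
  by (simp_all add: Hom_module_def)

lemma End_algebra_simps [simp]:
  "carrier (End_algebra R N) = linear_maps R N N"
  "mult (End_algebra R N) = compose (carrier N)"
  "one (End_algebra R N) = (\<lambda>x \<in> carrier N. x)"
  "add (End_algebra R N) = (\<lambda>f g. \<lambda>x \<in> carrier N. f x \<oplus>\<^bsub>N\<^esub> g x)"
  "smult (End_algebra R N) = (\<lambda>r f. \<lambda>x \<in> carrier N. r \<odot>\<^bsub>N\<^esub> f x)"
  by (simp_all add: End_algebra_def fun_eq_iff)

lemma trace_module_simps [simp]:
  "carrier (trace_module R N) = trace_ideal R N" "add (trace_module R N) = add R"
  "zero (trace_module R N) = zero R" "smult (trace_module R N) = mult R"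
  by (simp_all add: trace_module_def)

lemma ring_center_simps [simp]:
  "carrier (ring_center S) = {z \<in> carrier S. \<forall>x \<in> carrier S. z \<otimes>\<^bsub>S\<^esub> x = x \<otimes>\<^bsub>S\<^esub> z}"
  "mult (ring_center S) = mult S" "one (ring_center S) = one S" "add (ring_center S) = add S"
  by (simp_all add: ring_center_def)

lemma smult_ring_center [simp]: "smult (ring_center S) = smult S"
  by (simp add: ring_center_def)

lemma linear_mapsI:
  assumes "\<And>x. x \<in> carrier N \<Longrightarrow> f x \<in> carrier P" "f \<in> extensional (carrier N)"
    and "\<And>x y. x \<in> carrier N \<Longrightarrow> y \<in> carrier N \<Longrightarrow> f (x \<oplus>\<^bsub>N\<^esub> y) = f x \<oplus>\<^bsub>P\<^esub> f y"
    and "\<And>r x. r \<in> carrier R \<Longrightarrow> x \<in> carrier N \<Longrightarrow> f (r \<odot>\<^bsub>N\<^esub> x) = r \<odot>\<^bsub>P\<^esub> f x"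
  shows "f \<in> linear_maps R N P"
  using assms by (auto simp: linear_maps_def PiE_def)

lemma
  assumes "f \<in> linear_maps R N P"
  shows linear_maps_closed: "x \<in> carrier N \<Longrightarrow> f x \<in> carrier P"
    and linear_maps_extensional: "f \<in> extensional (carrier N)"
    and linear_maps_add:
      "x \<in> carrier N \<Longrightarrow> y \<in> carrier N \<Longrightarrow> f (x \<oplus>\<^bsub>N\<^esub> y) = f x \<oplus>\<^bsub>P\<^esub> f y"
    and linear_maps_smult:
      "r \<in> carrier R \<Longrightarrow> x \<in> carrier N \<Longrightarrow> f (r \<odot>\<^bsub>N\<^esub> x) = r \<odot>\<^bsub>P\<^esub> f x"
  using assms by (auto simp: linear_maps_def PiE_def)

lemma linear_maps_eqI:
  assumes "f \<in> linear_maps R N P" "g \<in> linear_maps R N Q" "\<And>x. x \<in> carrier N \<Longrightarrow> f x = g x"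
  shows "f = g"
  using assms linear_maps_extensional by (metis extensionalityI)

lemma compose_linear_maps:
  assumes "f \<in> linear_maps R N P" "g \<in> linear_maps R P Q"
    and "\<And>x y. x \<in> carrier N \<Longrightarrow> y \<in> carrier N \<Longrightarrow> x \<oplus>\<^bsub>N\<^esub> y \<in> carrier N"
    and "\<And>r x. r \<in> carrier R \<Longrightarrow> x \<in> carrier N \<Longrightarrow> r \<odot>\<^bsub>N\<^esub> x \<in> carrier N"
  shows "compose (carrier N) g f \<in> linear_maps R N Q"
  using assms
  by (intro linear_mapsI)
     (auto simp: compose_def linear_maps_closed linear_maps_add linear_maps_smult)

lemma (in cring) module_ring_module: "module R (ring_module R)"
  by (rule moduleI)
    (auto intro!: abelian_groupI is_cring a_assoc a_comm simp: l_distr r_distr m_assoc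
      intro: l_neg bexI[of _ "\<ominus> x" for x])

lemma (in module) module_Hom_module:
  assumes "module R N"
  shows "module R (Hom_module R N M)"
proof -
  interpret N: module R N by fact
  have neg: "(\<lambda>x \<in> carrier N. \<ominus>\<^bsub>M\<^esub> f x) \<in> linear_maps R N M" if "f \<in> linear_maps R N M" for f
    using that by (intro linear_mapsI)
      (auto simp: linear_maps_closed linear_maps_add linear_maps_smult M.minus_add smult_r_minus)
  have add: "(\<lambda>x \<in> carrier N. f x \<oplus>\<^bsub>M\<^esub> g x) \<in> linear_maps R N M"
    if "f \<in> linear_maps R N M" "g \<in> linear_maps R N M" for f g
    using that by (intro linear_mapsI)
      (auto simp: linear_maps_closed linear_maps_add linear_maps_smult M.a_ac smult_r_distr)
  have smult: "(\<lambda>x \<in> carrier N. r \<odot>\<^bsub>M\<^esub> f x) \<in> linear_maps R N M"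
    if "r \<in> carrier R" "f \<in> linear_maps R N M" for r f
    using that by (intro linear_mapsI)
      (auto simp: linear_maps_closed linear_maps_add linear_maps_smult smult_r_distr m_comm
        simp flip: smult_assoc1)
  have zero: "(\<lambda>x \<in> carrier N. \<zero>\<^bsub>M\<^esub>) \<in> linear_maps R N M"
    by (intro linear_mapsI) auto
  show ?thesis
  proof (rule moduleI)
    show "abelian_group (Hom_module R N M)"
    proof (rule abelian_groupI)
      fix f assume f: "f \<in> carrier (Hom_module R N M)"
      then show "\<exists>g\<in>carrier (Hom_module R N M). g \<oplus>\<^bsub>Hom_module R N M\<^esub> f = \<zero>\<^bsub>Hom_module R N M\<^esub>"
        using neg[of f] by (intro bexI[of _ "\<lambda>x \<in> carrier N. \<ominus>\<^bsub>M\<^esub> f x"])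
          (auto simp: linear_maps_closed M.l_neg cong: restrict_cong)
      show "\<zero>\<^bsub>Hom_module R N M\<^esub> \<oplus>\<^bsub>Hom_module R N M\<^esub> f = f"
        using f linear_maps_extensional[of f R N M]
        by (auto simp: linear_maps_closed fun_eq_iff extensional_def)
    qed (use add zero in \<open>auto simp: linear_maps_closed M.a_ac cong: restrict_cong\<close>)
    fix f assume f: "f \<in> carrier (Hom_module R N M)"
    then show "\<one> \<odot>\<^bsub>Hom_module R N M\<^esub> f = f"
      using linear_maps_extensional[of f R N M]
      by (auto simp: linear_maps_closed fun_eq_iff extensional_def)
  qed (use smult in \<open>auto simp: linear_maps_closed smult_r_distr smult_l_distr smult_assoc1 is_cring
         cong: restrict_cong\<close>)
qed

lemma (in module) module_dual_module: "module R (dual_module R M)"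
  unfolding dual_module_def
  by (rule module.module_Hom_module[OF module_ring_module]) (rule module_axioms)

lemma dual_module_simps [simp]:
  "carrier (dual_module R N) = linear_maps R N (ring_module R)"
  "zero (dual_module R N) = (\<lambda>x \<in> carrier N. \<zero>\<^bsub>R\<^esub>)"
  "add (dual_module R N) = (\<lambda>f g. \<lambda>x \<in> carrier N. f x \<oplus>\<^bsub>R\<^esub> g x)"
  "smult (dual_module R N) = (\<lambda>r f. \<lambda>x \<in> carrier N. r \<otimes>\<^bsub>R\<^esub> f x)"
  by (simp_all add: dual_module_def)

section \<open>Ideals and multiplication by fractions\<close>

context cring
begin

lemma ideal_of_submodule:
  assumes "I \<subseteq> carrier R" "\<zero> \<in> I" "\<And>a b. a \<in> I \<Longrightarrow> b \<in> I \<Longrightarrow> a \<oplus> b \<in> I"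
    and mult: "\<And>r a. r \<in> carrier R \<Longrightarrow> a \<in> I \<Longrightarrow> r \<otimes> a \<in> I"
  shows "ideal I R"
proof (rule idealI)
  have "\<ominus> a \<in> I" if "a \<in> I" for a
    using mult[of "\<ominus> \<one>" a] that assms(1) by (auto simp: l_minus)
  then show "subgroup I (add_monoid R)"
    using assms by (intro subgroup.intro) (auto simp: a_inv_def[symmetric])
  show "a \<otimes> r \<in> I" if "a \<in> I" "r \<in> carrier R" for a r
    using mult[of r a] that assms(1) m_comm[of a r] by auto
qed (use assms in \<open>auto intro: ring_axioms\<close>)

lemma nonzerodivisor_cancel:
  assumes "nonzerodivisor R x" "a \<in> carrier R" "b \<in> carrier R" "x \<otimes> a = x \<otimes> b"
  shows "a = b"
proof -
  have "x \<otimes> (a \<ominus> b) = \<zero>"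
    using assms by (simp add: nonzerodivisor_def a_minus_def r_distr r_minus r_neg)
  then have "a \<ominus> b = \<zero>"
    using assms by (simp add: nonzerodivisor_def)
  then show ?thesis
    using assms by simp
qed

text \<open>When \<open>x\<close> is a nonzerodivisor, this set consists of the \<open>j\<close>
  that the fraction c/x carries into \<open>J\<close>. Because it is an ideal, an inclusion of a
  trace ideal in it can be tested on the values of functionals.\<close>

lemma ideal_fraction:
  assumes "ideal J R" "x \<in> carrier R" "c \<in> carrier R"
  shows "ideal {j \<in> carrier R. \<exists>r\<in>J. x \<otimes> r = c \<otimes> j} R"
proof -
  interpret J: ideal J R by fact
  show ?thesis
  proof (rule ideal_of_submodule)
    fix a b assume "a \<in> {j \<in> carrier R. \<exists>r\<in>J. x \<otimes> r = c \<otimes> j}" "b \<in> {j \<in> carrier R. \<exists>r\<in>J. x \<otimes> r = c \<otimes> j}"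
    then obtain r s where "a \<in> carrier R" "b \<in> carrier R" "r \<in> J" "s \<in> J"
      "x \<otimes> r = c \<otimes> a" "x \<otimes> s = c \<otimes> b" by auto
    then show "a \<oplus> b \<in> {j \<in> carrier R. \<exists>r\<in>J. x \<otimes> r = c \<otimes> j}"
      using assms by (auto simp: r_distr J.Icarr intro!: bexI[of _ "r \<oplus> s"])
  next
    fix t a assume t: "t \<in> carrier R" and "a \<in> {j \<in> carrier R. \<exists>r\<in>J. x \<otimes> r = c \<otimes> j}"
    then obtain r where "a \<in> carrier R" "r \<in> J" "x \<otimes> r = c \<otimes> a" by auto
    with t show "t \<otimes> a \<in> {j \<in> carrier R. \<exists>r\<in>J. x \<otimes> r = c \<otimes> j}"
      using assms
      by (auto simp: J.Icarr m_lcomm[of x t] m_lcomm[of c t] J.I_l_closed intro!: bexI[of _ "t \<otimes> r"])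
  qed (use assms in \<open>auto intro!: bexI[of _ \<zero>]\<close>)
qed

text \<open>A chosen \<open>r\<close> is the only possible one, since \<open>x\<close> can be
  cancelled. So the choice function is automatically linear: both sides of each law agree after
  multiplication by \<open>x\<close>, where they become statements about multiplication by
  \<open>c\<close>. Fixing only three fields of \<open>N\<close> lets the lemma serve the trace
  modules of both \<open>M\<close> and its dual.\<close>

lemma fraction_linear_map:
  assumes "ideal I R" "nonzerodivisor R x" "c \<in> carrier R"
    and ex: "\<And>j. j \<in> I \<Longrightarrow> \<exists>r\<in>I. x \<otimes> r = c \<otimes> j"
    and N: "carrier N = I" "add N = add R" "smult N = mult R"
  obtains f where "f \<in> linear_maps R N N" "\<And>j. j \<in> I \<Longrightarrow> x \<otimes> f j = c \<otimes> j"
proof -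
  interpret I: ideal I R by fact
  have x: "x \<in> carrier R" using assms(2) by (simp add: nonzerodivisor_def)
  have "\<forall>j\<in>I. \<exists>r. r \<in> I \<and> x \<otimes> r = c \<otimes> j" using ex by blast
  then obtain g where "\<forall>j\<in>I. g j \<in> I \<and> x \<otimes> g j = c \<otimes> j"
    by (rule bchoice[THEN exE])
  then have g: "\<And>j. j \<in> I \<Longrightarrow> g j \<in> I" "\<And>j. j \<in> I \<Longrightarrow> x \<otimes> g j = c \<otimes> j" by simp_all
  have gR: "g j \<in> carrier R" if "j \<in> I" for j by (rule I.Icarr[OF g(1)[OF that]])
  show thesis
  proof (rule that[of "restrict g I"])
    show "restrict g I \<in> linear_maps R N N"
    proof (rule linear_mapsI)
      fix i j assume "i \<in> carrier N" "j \<in> carrier N"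
      then have ij: "i \<in> I" "j \<in> I" "i \<oplus> j \<in> I" using N by auto
      then have "x \<otimes> g (i \<oplus> j) = x \<otimes> (g i \<oplus> g j)"
        using x assms(3) by (simp add: g gR r_distr I.Icarr)
      then have "g (i \<oplus> j) = g i \<oplus> g j"
        using ij gR by - (rule nonzerodivisor_cancel[OF assms(2)], auto)
      then show "restrict g I (i \<oplus>\<^bsub>N\<^esub> j) = restrict g I i \<oplus>\<^bsub>N\<^esub> restrict g I j"
        using ij by (simp add: N)
    next
      fix r j assume r: "r \<in> carrier R" and "j \<in> carrier N"
      then have j: "j \<in> I" "r \<otimes> j \<in> I" using N by (auto simp: I.I_l_closed)
      then have "x \<otimes> g (r \<otimes> j) = x \<otimes> (r \<otimes> g j)"
        using x r assms(3) m_lcomm[of x r "g j"] m_lcomm[of c r j] by (simp add: g gR I.Icarr)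
      then have "g (r \<otimes> j) = r \<otimes> g j"
        using j r gR by - (rule nonzerodivisor_cancel[OF assms(2)], auto)
      then show "restrict g I (r \<odot>\<^bsub>N\<^esub> j) = r \<odot>\<^bsub>N\<^esub> restrict g I j"
        using j by (simp add: N)
    qed (simp_all add: g N)
  qed (simp add: g)
qed

text \<open>Compute f(x i) in two ways, pulling out either factor as a scalar. If \<open>x\<close>
  is a nonzerodivisor, \<open>f\<close> is thus multiplication by f(x)/x and is determined by its
  value at \<open>x\<close>.\<close>

lemma linear_map_fraction:
  assumes "f \<in> linear_maps R N P" "carrier N \<subseteq> carrier R" "smult N = mult R" "smult P = mult R"
    and "i \<in> carrier N" "x \<in> carrier N" "carrier P \<subseteq> carrier R"
  shows "x \<otimes> f i = f x \<otimes> i"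
proof -
  have "x \<otimes> f i = f (x \<otimes> i)" "i \<otimes> f x = f (i \<otimes> x)"
    using linear_maps_smult[OF assms(1)] assms by auto
  moreover have "f x \<in> carrier R"
    using linear_maps_closed[OF assms(1)] assms by auto
  ultimately show ?thesis
    using assms by (simp add: m_comm subset_iff)
qed

section \<open>Positive grade yields a nonzerodivisor\<close>

text \<open>The first entry is regular modulo the ideal generated by the empty set. That ideal is
  zero and its cosets are singletons, so a relation x y = 0 in \<open>R\<close> transfers to the
  quotient and its conclusion transfers back.\<close>

lemma nonzerodivisor_of_regular_sequence:
  assumes "regular_sequence R (x # xs)"
  shows "nonzerodivisor R x"
proof -
  have x: "x \<in> carrier R"
    and nzd: "nonzerodivisor (R Quot (Idl {})) (Idl {} +> x)"
    using assms by (auto simp: regular_sequence_def)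
  have I: "Idl {} = {\<zero>}"
  proof
    show "Idl {} \<subseteq> {\<zero>}" by (rule genideal_minimal[OF zeroideal]) simp
    interpret E: ideal "Idl {}" R by (rule genideal_ideal) simp
    show "{\<zero>} \<subseteq> Idl {}" by simp
  qed
  have coset: "{\<zero>} +> a = {a}" if "a \<in> carrier R" for a
    using that by (auto simp: a_r_coset_def')
  interpret Z: ideal "{\<zero>}" R by (rule zeroideal)
  show ?thesis
    unfolding nonzerodivisor_def
  proof (intro conjI ballI impI x)
    fix y assume y: "y \<in> carrier R" "x \<otimes> y = \<zero>"
    have "({\<zero>} +> x) \<otimes>\<^bsub>R Quot {\<zero>}\<^esub> ({\<zero>} +> y) = \<zero>\<^bsub>R Quot {\<zero>}\<^esub>"
      using x y Z.rcoset_mult_add[of x y] by (simp add: FactRing_def coset)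
    moreover have "{\<zero>} +> y \<in> carrier (R Quot {\<zero>})"
      using y by (auto simp: FactRing_def A_RCOSETS_def')
    ultimately have "{\<zero>} +> y = \<zero>\<^bsub>R Quot {\<zero>}\<^esub>"
      using nzd unfolding I nonzerodivisor_def by blast
    then show "y = \<zero>"
      using y by (simp add: FactRing_def coset)
  qed
qed

text \<open>
  Without a nonzerodivisor in \<open>I\<close> the empty sequence is the only regular sequence in \<open>I\<close>, so the
  description in the definition of \<open>grade\<close> is proper; no appeal to Rees' theorem is needed.
\<close>

lemma nonzerodivisor_of_grade_pos:
  assumes I: "I \<subseteq> carrier R" "\<zero> \<in> I" and grade: "0 < grade R I"
  shows "\<exists>x \<in> I. nonzerodivisor R x"
proof (cases "I = carrier R")
  case True
  then show ?thesis by (intro bexI[of _ \<one>]) (auto simp: nonzerodivisor_def)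
next
  case False
  show ?thesis
  proof (rule ccontr)
    assume no: "\<not> ?thesis"
    \<comment> \<open>The empty sequence is regular only if the zero ideal is proper. Otherwise
      \<open>R\<close> would be the zero ring, and \<open>I\<close>, which contains zero, would be
      all of \<open>R\<close>.\<close>
    have "Idl {} \<noteq> carrier R"
    proof
      assume "Idl {} = carrier R"
      moreover have "Idl {} \<subseteq> {\<zero>}" by (rule genideal_minimal[OF zeroideal]) simp
      ultimately show False using I False by auto
    qed
    then have "regular_sequence R []" by (simp add: regular_sequence_def)
    moreover have "xs = []" if "regular_sequence R xs" "set xs \<subseteq> I" for xs
      using that no nonzerodivisor_of_regular_sequence by (cases xs) auto
    moreover have "\<not> regular_sequence R [x]" if "x \<in> I" for x
      using that no nonzerodivisor_of_regular_sequence by blast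
    ultimately have "{xs. maximal_regular_sequence R I xs} = {[]}"
      by (auto simp: maximal_regular_sequence_def)
    then have "grade R I = 0"
      using False by (simp add: grade_def zero_enat_def)
    with grade show False by simp
  qed
qed

end

section \<open>The trace ideal: generators, closure properties and maps on it\<close>

context module
begin

lemma dual_closed: "\<alpha> \<in> linear_maps R M (ring_module R) \<Longrightarrow> m \<in> carrier M \<Longrightarrow> \<alpha> m \<in> carrier R"
  using linear_maps_closed by fastforce

lemma dual_add:
  "\<lbrakk>\<alpha> \<in> linear_maps R M (ring_module R); m \<in> carrier M; n \<in> carrier M\<rbrakk> \<Longrightarrow>
    \<alpha> (m \<oplus>\<^bsub>M\<^esub> n) = \<alpha> m \<oplus> \<alpha> n"
  using linear_maps_add by fastforce

lemma dual_smult: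
  "\<lbrakk>\<alpha> \<in> linear_maps R M (ring_module R); r \<in> carrier R; m \<in> carrier M\<rbrakk> \<Longrightarrow>
    \<alpha> (r \<odot>\<^bsub>M\<^esub> m) = r \<otimes> \<alpha> m"
  using linear_maps_smult by fastforce

lemma dual_zero:
  assumes "\<alpha> \<in> linear_maps R M (ring_module R)"
  shows "\<alpha> \<zero>\<^bsub>M\<^esub> = \<zero>"
  using dual_smult[OF assms, of \<zero> "\<zero>\<^bsub>M\<^esub>"] dual_closed[OF assms] by simp

lemma trace_idealI:
  assumes "finite A" "A \<subseteq> linear_maps R M (ring_module R)" "s \<in> (\<Pi> \<alpha>\<in>A. \<alpha> ` carrier M)"
  shows "(\<Oplus>\<alpha>\<in>A. s \<alpha>) \<in> trace_ideal R M"
  using assms unfolding trace_ideal_def dual_module_simps by blast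

lemma trace_ideal_generator:
  assumes "\<alpha> \<in> linear_maps R M (ring_module R)" "m \<in> carrier M"
  shows "\<alpha> m \<in> trace_ideal R M"
  using trace_idealI[of "{\<alpha>}" "\<lambda>_. \<alpha> m"] assms by (simp add: dual_closed)

text \<open>This acts as an induction principle: a property passes from the values \<alpha>(m) to
  the whole trace ideal once the elements having it form an ideal.\<close>

lemma trace_ideal_least:
  assumes "ideal K R"
    and K: "\<And>\<alpha> m. \<alpha> \<in> linear_maps R M (ring_module R) \<Longrightarrow> m \<in> carrier M \<Longrightarrow> \<alpha> m \<in> K"
  shows "trace_ideal R M \<subseteq> K"
proof
  interpret K: ideal K R by fact
  have "(\<Oplus>\<alpha>\<in>A. s \<alpha>) \<in> K" if "finite A" "s \<in> A \<rightarrow> K" for A and s :: "('c \<Rightarrow> 'a) \<Rightarrow> 'a"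
    using that
  proof (induction A rule: finite_induct)
    case (insert \<alpha> A)
    then have "s \<in> A \<rightarrow> carrier R" "s \<alpha> \<in> carrier R" by (auto intro: K.Icarr)
    with insert show ?case by (simp add: Pi_iff)
  qed simp
  moreover fix t assume "t \<in> trace_ideal R M"
  then obtain A s where A: "finite A" "A \<subseteq> linear_maps R M (ring_module R)"
    "s \<in> (\<Pi> \<alpha>\<in>A. \<alpha> ` carrier M)" "t = (\<Oplus>\<alpha>\<in>A. s \<alpha>)"
    unfolding trace_ideal_def by auto
  moreover have "s \<in> A \<rightarrow> K"
  proof
    fix \<alpha> assume "\<alpha> \<in> A"
    with A(3) obtain m where "m \<in> carrier M" "s \<alpha> = \<alpha> m" by auto
    with A(2) \<open>\<alpha> \<in> A\<close> K[of \<alpha> m] show "s \<alpha> \<in> K" by auto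
  qed
  ultimately show "t \<in> K" by blast
qed

text \<open>The definition admits one summand per functional, so two sums cannot simply be
  concatenated. Over a common index set they are added termwise, using \<alpha>(m) + \<alpha>(n) =
  \<alpha>(m + n). A scalar is absorbed termwise as r \<alpha>(m) = \<alpha>(r m).\<close>

lemma ideal_trace_ideal: "ideal (trace_ideal R M) R"
proof (rule ideal_of_submodule)
  have s_closed: "s \<in> A \<rightarrow> carrier R"
    if "A \<subseteq> linear_maps R M (ring_module R)" "s \<in> (\<Pi> \<alpha>\<in>A. \<alpha> ` carrier M)" for A s
  proof
    fix \<alpha> assume "\<alpha> \<in> A"
    with that(2) obtain m where "m \<in> carrier M" "s \<alpha> = \<alpha> m" by auto
    with that(1) \<open>\<alpha> \<in> A\<close> dual_closed[of \<alpha> m] show "s \<alpha> \<in> carrier R" by auto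
  qed
  show "trace_ideal R M \<subseteq> carrier R"
    by (rule trace_ideal_least[OF oneideal]) (simp add: dual_closed)
  show "\<zero> \<in> trace_ideal R M"
    using trace_idealI[of "{}"] by simp
  show "r \<otimes> a \<in> trace_ideal R M" if r: "r \<in> carrier R" and "a \<in> trace_ideal R M" for r a
  proof -
    obtain A s where A: "finite A" "A \<subseteq> linear_maps R M (ring_module R)"
      "s \<in> (\<Pi> \<alpha>\<in>A. \<alpha> ` carrier M)" "a = (\<Oplus>\<alpha>\<in>A. s \<alpha>)"
      using \<open>a \<in> _\<close> unfolding trace_ideal_def by auto
    have "(\<lambda>\<alpha>. r \<otimes> s \<alpha>) \<in> (\<Pi> \<alpha>\<in>A. \<alpha> ` carrier M)"
    proof
      fix \<alpha> assume \<alpha>: "\<alpha> \<in> A"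
      with A(3) obtain m where "m \<in> carrier M" "s \<alpha> = \<alpha> m" by auto
      with \<alpha> A(2) r show "r \<otimes> s \<alpha> \<in> \<alpha> ` carrier M"
        by (intro image_eqI[of _ _ "r \<odot>\<^bsub>M\<^esub> m"]) (auto simp: dual_smult subset_iff)
    qed
    moreover have "r \<otimes> a = (\<Oplus>\<alpha>\<in>A. r \<otimes> s \<alpha>)"
      using A r s_closed by (simp add: finsum_rdistr)
    ultimately show ?thesis
      using trace_idealI[OF A(1,2)] by simp
  qed
  show "a \<oplus> b \<in> trace_ideal R M" if "a \<in> trace_ideal R M" "b \<in> trace_ideal R M" for a b
  proof -
    obtain A s where A: "finite A" "A \<subseteq> linear_maps R M (ring_module R)"
      "s \<in> (\<Pi> \<alpha>\<in>A. \<alpha> ` carrier M)" "a = (\<Oplus>\<alpha>\<in>A. s \<alpha>)"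
      using \<open>a \<in> _\<close> unfolding trace_ideal_def by auto
    obtain B t where B: "finite B" "B \<subseteq> linear_maps R M (ring_module R)"
      "t \<in> (\<Pi> \<alpha>\<in>B. \<alpha> ` carrier M)" "b = (\<Oplus>\<alpha>\<in>B. t \<alpha>)"
      using \<open>b \<in> _\<close> unfolding trace_ideal_def by auto
    \<comment> \<open>Padding by zero brings both sums to the index set \<open>A \<union> B\<close>;
      the added terms are admissible because zero is the value of every functional at zero.\<close>
    have extend: "\<exists>u \<in> (\<Pi> \<alpha>\<in>A \<union> B. \<alpha> ` carrier M). (\<Oplus>\<alpha>\<in>C. s \<alpha>) = (\<Oplus>\<alpha>\<in>A \<union> B. u \<alpha>)"
      if C: "C \<subseteq> A \<union> B" and s: "s \<in> (\<Pi> \<alpha>\<in>C. \<alpha> ` carrier M)" for C s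
    proof (intro bexI)
      let ?u = "\<lambda>\<alpha>. if \<alpha> \<in> C then s \<alpha> else \<zero>"
      have "\<zero> \<in> \<alpha> ` carrier M" if "\<alpha> \<in> A \<union> B" for \<alpha>
        using that A(2) B(2) by (intro image_eqI[of _ _ "\<zero>\<^bsub>M\<^esub>"]) (auto simp: dual_zero subset_iff)
      with s show "?u \<in> (\<Pi> \<alpha>\<in>A \<union> B. \<alpha> ` carrier M)"
        by (simp add: Pi_iff)
      have sC: "s \<in> C \<rightarrow> carrier R"
        using s_closed[of C s] s C A(2) B(2) by blast
      show "(\<Oplus>\<alpha>\<in>C. s \<alpha>) = (\<Oplus>\<alpha>\<in>A \<union> B. ?u \<alpha>)"
        using sC by (intro R.add.finprod_mono_neutral_cong_left C)
          (simp_all add: A(1) B(1) Pi_iff)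
    qed
    obtain u where u: "u \<in> (\<Pi> \<alpha>\<in>A \<union> B. \<alpha> ` carrier M)" "a = (\<Oplus>\<alpha>\<in>A \<union> B. u \<alpha>)"
      using extend[of A s] A by auto
    obtain v where v: "v \<in> (\<Pi> \<alpha>\<in>A \<union> B. \<alpha> ` carrier M)" "b = (\<Oplus>\<alpha>\<in>A \<union> B. v \<alpha>)"
      using extend[of B t] B by auto
    have "(\<lambda>\<alpha>. u \<alpha> \<oplus> v \<alpha>) \<in> (\<Pi> \<alpha>\<in>A \<union> B. \<alpha> ` carrier M)"
    proof
      fix \<alpha> assume \<alpha>: "\<alpha> \<in> A \<union> B"
      obtain m n where mn: "m \<in> carrier M" "u \<alpha> = \<alpha> m" "n \<in> carrier M" "v \<alpha> = \<alpha> n"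
        using Pi_mem[OF u(1) \<alpha>] Pi_mem[OF v(1) \<alpha>] by blast
      have "\<alpha> \<in> linear_maps R M (ring_module R)" using \<alpha> A(2) B(2) by blast
      with mn show "u \<alpha> \<oplus> v \<alpha> \<in> \<alpha> ` carrier M"
        by (intro image_eqI[of _ _ "m \<oplus>\<^bsub>M\<^esub> n"]) (auto simp: dual_add)
    qed
    moreover have "a \<oplus> b = (\<Oplus>\<alpha>\<in>A \<union> B. u \<alpha> \<oplus> v \<alpha>)"
      using u v A B s_closed[of "A \<union> B"] by (simp)
    ultimately show ?thesis
      using trace_idealI[of "A \<union> B"] A(1,2) B(1,2) by simp
  qed
qed

lemma trace_carrier: "a \<in> trace_ideal R M \<Longrightarrow> a \<in> carrier R"
  using ideal.Icarr[OF ideal_trace_ideal] .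

text \<open>Narrowing the codomain allows a functional to be followed by a map defined only on the
  trace ideal.\<close>

lemma dual_to_trace:
  assumes "\<alpha> \<in> linear_maps R M (ring_module R)"
  shows "\<alpha> \<in> linear_maps R M (trace_module R M)"
  using assms by (intro linear_mapsI)
    (auto simp: trace_ideal_generator dual_add dual_smult linear_maps_extensional)

lemma compose_dual:
  assumes "\<alpha> \<in> linear_maps R M (ring_module R)"
    and "f \<in> linear_maps R (trace_module R M) (ring_module R)"
  shows "compose (carrier M) f \<alpha> \<in> linear_maps R M (ring_module R)"
  using compose_linear_maps[OF dual_to_trace[OF assms(1)] assms(2)] by simp

text \<open>On a generator, f(\<alpha>(m)) = (f \<circ> \<alpha>)(m), and f \<circ> \<alpha> is
  again a functional on \<open>M\<close>. Hence every linear map from the trace ideal to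
  \<open>R\<close> is an endomorphism of the trace ideal.\<close>

lemma linear_map_trace_ideal:
  assumes f: "f \<in> linear_maps R (trace_module R M) (ring_module R)" and a: "a \<in> trace_ideal R M"
  shows "f a \<in> trace_ideal R M"
proof -
  interpret I: ideal "trace_ideal R M" R by (rule ideal_trace_ideal)
  have add: "f (a \<oplus> b) = f a \<oplus> f b" if "a \<in> trace_ideal R M" "b \<in> trace_ideal R M" for a b
    using linear_maps_add[OF f] that by simp
  have smult: "f (r \<otimes> a) = r \<otimes> f a" if "r \<in> carrier R" "a \<in> trace_ideal R M" for r a
    using linear_maps_smult[OF f] that by simp
  have "f a \<in> carrier R" if "a \<in> trace_ideal R M" for a
    using linear_maps_closed[OF f] that by simp
  then have "f \<zero> = \<zero>" using smult[of \<zero> \<zero>] by simp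
  then have "ideal {a \<in> trace_ideal R M. f a \<in> trace_ideal R M} R"
    by (intro ideal_of_submodule) (auto simp: add smult trace_carrier I.I_l_closed)
  then have "trace_ideal R M \<subseteq> {a \<in> trace_ideal R M. f a \<in> trace_ideal R M}"
  proof (rule trace_ideal_least)
    fix \<alpha> m assume "\<alpha> \<in> linear_maps R M (ring_module R)" "m \<in> carrier M"
    then show "\<alpha> m \<in> {a \<in> trace_ideal R M. f a \<in> trace_ideal R M}"
      using trace_ideal_generator[OF compose_dual[OF _ f]]
      by (fastforce simp: compose_eq trace_ideal_generator)
  qed
  with a show ?thesis by blast
qed

lemma trace_endo_to_ring:
  assumes "f \<in> linear_maps R (trace_module R M) (trace_module R M)"
  shows "f \<in> linear_maps R (trace_module R M) (ring_module R)"
  using assms linear_maps_closed[OF assms] linear_maps_add[OF assms] linear_maps_smult[OF assms]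
  by (intro linear_mapsI) (auto simp: trace_carrier dest: linear_maps_extensional)

lemma trace_linear_map_fraction:
  assumes "f \<in> linear_maps R (trace_module R M) (trace_module R M)"
    and "x \<in> trace_ideal R M" "i \<in> trace_ideal R M"
  shows "x \<otimes> f i = f x \<otimes> i"
  using assms by (intro linear_map_fraction[OF assms(1)]) (auto simp: trace_carrier)

lemma trace_endo_closed:
  assumes "f \<in> linear_maps R (trace_module R M) (trace_module R M)" "i \<in> trace_ideal R M"
  shows "f i \<in> trace_ideal R M"
  using linear_maps_closed[OF assms(1)] assms(2) by simp

text \<open>The element \<alpha>(m) is also the value at \<alpha> of evaluation at \<open>m\<close>,
  which is a functional on the dual.\<close>

lemma trace_ideal_dual_supset: "trace_ideal R M \<subseteq> trace_ideal R (dual_module R M)"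
proof -
  interpret D: module R "dual_module R M" by (rule module_dual_module)
  show ?thesis
  proof (rule trace_ideal_least[OF D.ideal_trace_ideal])
    fix \<alpha> m assume \<alpha>: "\<alpha> \<in> linear_maps R M (ring_module R)" and m: "m \<in> carrier M"
    let ?ev = "\<lambda>\<beta> \<in> linear_maps R M (ring_module R). \<beta> m"
    have "?ev \<in> linear_maps R (dual_module R M) (ring_module R)"
      using m D.add.m_closed D.smult_closed
      by (intro linear_mapsI) (auto simp: dual_closed)
    from D.trace_ideal_generator[OF this, of \<alpha>] \<alpha>
    show "\<alpha> m \<in> trace_ideal R (dual_module R M)" by simp
  qed
qed

section \<open>Endomorphisms of the two trace ideals\<close>

text \<open>Restriction respects composition because endomorphisms of the larger ideal preserve the
  smaller one. Since \<open>x\<close> lies in both ideals, an endomorphism of either is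
  multiplication by the fraction given by its value at \<open>x\<close>; bijectivity compares these
  fractions.\<close>

lemma End_trace_dual_iso:
  assumes x: "x \<in> trace_ideal R M" "nonzerodivisor R x"
  shows "is_alg_iso R (End_algebra R (trace_module R (dual_module R M)))
           (End_algebra R (trace_module R M))"
proof -
  interpret D: module R "dual_module R M" by (rule module_dual_module)
  define I where "I = trace_ideal R M"
  define J where "J = trace_ideal R (dual_module R M)"
  interpret I: ideal I R unfolding I_def by (rule ideal_trace_ideal)
  interpret J: ideal J R unfolding J_def by (rule D.ideal_trace_ideal)
  have IJ: "I \<subseteq> J" unfolding I_def J_def by (rule trace_ideal_dual_supset)
  let ?EI = "linear_maps R (trace_module R M) (trace_module R M)"
  let ?EJ = "linear_maps R (trace_module R (dual_module R M)) (trace_module R (dual_module R M))"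
  have xI: "x \<in> I" and xJ: "x \<in> J" and xR: "x \<in> carrier R"
    using x IJ by (auto simp: I_def trace_carrier)
  let ?h = "\<lambda>f. restrict f I"
  \<comment> \<open>A priori \<open>f\<close> only maps \<open>I\<close> into \<open>J\<close>. Its
    restriction is a linear map from \<open>I\<close> to \<open>R\<close>, and such a map has values
    in \<open>I\<close>.\<close>
  have restr_I: "f i \<in> I" if f: "f \<in> ?EJ" and i: "i \<in> I" for f i
  proof -
    have "restrict f I \<in> linear_maps R (trace_module R M) (ring_module R)"
      using IJ D.trace_endo_closed[OF f] linear_maps_add[OF f] linear_maps_smult[OF f]
      by (intro linear_mapsI) (auto simp: D.trace_carrier subset_iff I.I_l_closed simp flip: I_def J_def)
    from linear_map_trace_ideal[OF this] i show ?thesis by (simp add: I_def)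
  qed
  have h_closed: "?h f \<in> ?EI" if f: "f \<in> ?EJ" for f
    using IJ restr_I[OF f] linear_maps_add[OF f] linear_maps_smult[OF f]
    by (intro linear_mapsI) (auto simp: subset_iff I.I_l_closed simp flip: I_def J_def)
  \<comment> \<open>As \<open>x\<close> is in \<open>I\<close>, equal restrictions give equal values
    at \<open>x\<close>, hence equal fractions on all of \<open>J\<close>.\<close>
  have inj: "inj_on ?h ?EJ"
  proof (rule inj_onI)
    fix f g assume f: "f \<in> ?EJ" and g: "g \<in> ?EJ" and "?h f = ?h g"
    then have fx: "f x = g x" using xI by (metis restrict_apply')
    show "f = g"
    proof (rule linear_maps_eqI[OF f g])
      fix j assume "j \<in> carrier (trace_module R (dual_module R M))"
      then have j: "j \<in> J" by (simp add: J_def)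
      have "x \<otimes> f j = x \<otimes> g j"
        using D.trace_linear_map_fraction[OF f, of x j] D.trace_linear_map_fraction[OF g, of x j]
          j xJ fx by (simp add: J_def)
      moreover have "f j \<in> carrier R" "g j \<in> carrier R"
        using D.trace_carrier D.trace_endo_closed[OF f] D.trace_endo_closed[OF g] j
        by (simp_all add: J_def)
      ultimately show "f j = g j"
        using nonzerodivisor_cancel[OF x(2)] by blast
    qed
  qed
  have surj: "\<exists>g \<in> ?EJ. ?h g = f" if f: "f \<in> ?EI" for f
  proof -
    have fx: "f x \<in> carrier R" using trace_endo_closed[OF f x(1)] trace_carrier by blast
    \<comment> \<open>In the dual, x (f \<circ> \<alpha>) = f(x) \<alpha>. Applying \<phi> shows
      that \<phi>(f \<circ> \<alpha>), an element of \<open>J\<close>, is the required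
      \<open>r\<close> for the generator \<phi>(\<alpha>).\<close>
    have "J \<subseteq> {j \<in> carrier R. \<exists>r\<in>J. x \<otimes> r = f x \<otimes> j}"
      unfolding J_def
    proof (rule D.trace_ideal_least)
      fix \<phi> \<alpha> assume \<phi>: "\<phi> \<in> linear_maps R (dual_module R M) (ring_module R)"
        and "\<alpha> \<in> carrier (dual_module R M)"
      then have \<alpha>: "\<alpha> \<in> linear_maps R M (ring_module R)" by simp
      let ?f\<alpha> = "compose (carrier M) f \<alpha>"
      have f\<alpha>: "?f\<alpha> \<in> carrier (dual_module R M)"
        using compose_dual[OF \<alpha> trace_endo_to_ring[OF f]] by simp
      have "x \<odot>\<^bsub>dual_module R M\<^esub> ?f\<alpha> = f x \<odot>\<^bsub>dual_module R M\<^esub> \<alpha>"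
        using trace_linear_map_fraction[OF f x(1)] trace_ideal_generator[OF \<alpha>]
        by (auto simp: compose_eq cong: restrict_cong)
      then have "x \<otimes> \<phi> ?f\<alpha> = f x \<otimes> \<phi> \<alpha>"
        using D.dual_smult[OF \<phi> xR f\<alpha>] D.dual_smult[OF \<phi> fx, of \<alpha>] \<alpha> by simp
      then show "\<phi> \<alpha> \<in> {j \<in> carrier R. \<exists>r\<in>trace_ideal R (dual_module R M). x \<otimes> r = f x \<otimes> j}"
        using D.trace_ideal_generator[OF \<phi> f\<alpha>] D.dual_closed[OF \<phi>] \<alpha> by auto
    qed (use ideal_fraction[OF J.ideal_axioms xR fx] J_def in simp)
    \<comment> \<open>The extension of \<open>f\<close> to \<open>J\<close> is multiplication by the
      same fraction f(x)/x.\<close>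
    then obtain g where g: "g \<in> ?EJ" "\<And>j. j \<in> J \<Longrightarrow> x \<otimes> g j = f x \<otimes> j"
      using fraction_linear_map[OF J.ideal_axioms x(2) fx, of "trace_module R (dual_module R M)"]
      by (auto simp: J_def subset_iff)
    have "?h g = f"
    proof (rule linear_maps_eqI[OF h_closed[OF g(1)] f])
      fix i assume "i \<in> carrier (trace_module R M)"
      then have i: "i \<in> I" by (simp add: I_def)
      have "x \<otimes> g i = x \<otimes> f i"
        using g(2)[of i] i IJ trace_linear_map_fraction[OF f x(1), of i] by (auto simp: I_def)
      moreover have "g i \<in> carrier R" "f i \<in> carrier R"
        using restr_I[OF g(1) i] trace_endo_closed[OF f, of i] i
        by (simp_all add: I_def trace_carrier)
      ultimately have "g i = f i"
        using nonzerodivisor_cancel[OF x(2)] by blast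
      then show "?h g i = f i" using i by simp
    qed
    with g show ?thesis by blast
  qed
  have "bij_betw ?h ?EJ ?EI"
    unfolding bij_betw_def using inj h_closed surj by (fastforce simp: image_iff)
  moreover have "?h \<in> ring_hom (End_algebra R (trace_module R (dual_module R M)))
      (End_algebra R (trace_module R M))"
    using h_closed restr_I IJ
    by (intro ring_hom_memI)
       (auto simp: compose_def fun_eq_iff restrict_def subset_iff simp flip: I_def J_def)
  moreover have "?h (r \<odot>\<^bsub>End_algebra R (trace_module R (dual_module R M))\<^esub> f) =
      r \<odot>\<^bsub>End_algebra R (trace_module R M)\<^esub> ?h f" for r f
    using IJ by (auto simp: fun_eq_iff restrict_def subset_iff simp flip: I_def J_def)
  ultimately have "?h \<in> alg_iso R (End_algebra R (trace_module R (dual_module R M)))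
      (End_algebra R (trace_module R M))"
    by (simp add: alg_iso_def ring_iso_def)
  then show ?thesis unfolding is_alg_iso_def by blast
qed

section \<open>Endomorphisms of the trace ideal and the center\<close>

text \<open>Functionals take values in the trace ideal, so its endomorphisms act on the dual by
  postcomposition. This action multiplies by fractions, which makes it central; conversely a central
  endomorphism turns out to be such a multiplication, and its fraction also preserves the trace
  ideal.\<close>

lemma End_trace_center_iso:
  assumes x: "x \<in> trace_ideal R M" "nonzerodivisor R x"
  shows "is_alg_iso R (End_algebra R (trace_module R M))
           (ring_center (End_algebra R (dual_module R M)))"
proof -
  interpret D: module R "dual_module R M" by (rule module_dual_module)
  interpret I: ideal "trace_ideal R M" R by (rule ideal_trace_ideal)
  let ?D = "linear_maps R M (ring_module R)"
  let ?EI = "linear_maps R (trace_module R M) (trace_module R M)"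
  let ?ED = "linear_maps R (dual_module R M) (dual_module R M)"
  let ?C = "{z \<in> ?ED. \<forall>F \<in> ?ED. compose ?D z F = compose ?D F z}"
  let ?h = "\<lambda>f. \<lambda>\<alpha> \<in> ?D. compose (carrier M) f \<alpha>"
  have xR: "x \<in> carrier R" using x trace_carrier by blast
  have add_D: "(\<lambda>m \<in> carrier M. \<alpha> m \<oplus> \<beta> m) \<in> ?D" if "\<alpha> \<in> ?D" "\<beta> \<in> ?D" for \<alpha> \<beta>
    using D.add.m_closed[of \<alpha> \<beta>] that by simp
  have smult_D: "(\<lambda>m \<in> carrier M. r \<otimes> \<alpha> m) \<in> ?D" if "r \<in> carrier R" "\<alpha> \<in> ?D" for r \<alpha>
    using D.smult_closed[of r \<alpha>] that by simp
  have ED_closed: "F \<alpha> \<in> ?D" if "F \<in> ?ED" "\<alpha> \<in> ?D" for F \<alpha>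
    using linear_maps_closed[OF that(1)] that(2) by simp
  have ED_smult: "F (\<lambda>m \<in> carrier M. r \<otimes> \<alpha> m) m = r \<otimes> F \<alpha> m"
    if "F \<in> ?ED" "\<alpha> \<in> ?D" "r \<in> carrier R" "m \<in> carrier M" for F \<alpha> r m
    using linear_maps_smult[OF that(1,3), of \<alpha>] that by simp
  have f\<alpha>: "compose (carrier M) f \<alpha> \<in> ?D" if "f \<in> ?EI" "\<alpha> \<in> ?D" for f \<alpha>
    using that compose_dual trace_endo_to_ring by blast
  have h_ED: "?h f \<in> ?ED" if f: "f \<in> ?EI" for f
    using f\<alpha>[OF f] linear_maps_add[OF f] linear_maps_smult[OF f] add_D smult_D
    by (intro linear_mapsI)
       (auto simp: compose_def trace_ideal_generator cong: restrict_cong)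
  have frac: "x \<otimes> f (\<alpha> m) = f x \<otimes> \<alpha> m" if "f \<in> ?EI" "\<alpha> \<in> ?D" "m \<in> carrier M" for f \<alpha> m
    using trace_linear_map_fraction that trace_ideal_generator x(1) by blast
  have h_center: "?h f \<in> ?C" if f: "f \<in> ?EI" for f
  proof -
    have fx: "f x \<in> carrier R" using trace_endo_closed[OF f x(1)] trace_carrier by blast
    \<comment> \<open>After multiplication by \<open>x\<close>, postcomposition with
      \<open>f\<close> becomes the scalar f(x), which passes through \<open>F\<close> by linearity.
      Cancelling \<open>x\<close> pointwise gives the claim.\<close>
    have "compose (carrier M) f (F \<alpha>) = F (compose (carrier M) f \<alpha>)" if F: "F \<in> ?ED" and \<alpha>: "\<alpha> \<in> ?D" for F \<alpha>
    proof (rule linear_maps_eqI[OF f\<alpha>[OF f ED_closed[OF F \<alpha>]] ED_closed[OF F f\<alpha>[OF f \<alpha>]]])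
      fix m assume m: "m \<in> carrier M"
      have "(\<lambda>m \<in> carrier M. x \<otimes> compose (carrier M) f \<alpha> m) = (\<lambda>m \<in> carrier M. f x \<otimes> \<alpha> m)"
        using frac[OF f \<alpha>] by (auto simp: compose_eq cong: restrict_cong)
      then have "x \<otimes> F (compose (carrier M) f \<alpha>) m = f x \<otimes> F \<alpha> m"
        using ED_smult[OF F f\<alpha>[OF f \<alpha>] xR m] ED_smult[OF F \<alpha> fx m] by simp
      also have "\<dots> = x \<otimes> f (F \<alpha> m)"
        using frac[OF f ED_closed[OF F \<alpha>] m] by simp
      finally show "compose (carrier M) f (F \<alpha>) m = F (compose (carrier M) f \<alpha>) m"
        using m dual_closed[OF f\<alpha>[OF f ED_closed[OF F \<alpha>]] m]
          dual_closed[OF ED_closed[OF F f\<alpha>[OF f \<alpha>]] m]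
        by - (rule nonzerodivisor_cancel[OF x(2)], auto simp: compose_eq)
    qed
    then show ?thesis
      using h_ED[OF f] f\<alpha>[OF f] ED_closed by (auto simp: compose_def cong: restrict_cong)
  qed
  \<comment> \<open>The elements on which \<open>f\<close> and \<open>g\<close> agree form an ideal.
    Equality of the images under \<open>?h\<close> puts every generator \<alpha>(m) into it.\<close>
  have inj: "inj_on ?h ?EI"
  proof (rule inj_onI)
    fix f g assume f: "f \<in> ?EI" and g: "g \<in> ?EI" and eq: "?h f = ?h g"
    have fg: "f (\<alpha> m) = g (\<alpha> m)" if "\<alpha> \<in> ?D" "m \<in> carrier M" for \<alpha> m
      using fun_cong[OF fun_cong[OF eq, of \<alpha>], of m] that by (simp add: compose_eq)
    have fgR: "f i \<in> carrier R" "g i \<in> carrier R" if "i \<in> trace_ideal R M" for i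
      using trace_endo_closed[OF f] trace_endo_closed[OF g] that trace_carrier by blast+
    have f0: "f \<zero> = g \<zero>"
      using linear_maps_smult[OF f, of \<zero> \<zero>] linear_maps_smult[OF g, of \<zero> \<zero>] fgR by simp
    have "ideal {i \<in> trace_ideal R M. f i = g i} R"
      using f0 linear_maps_add[OF f] linear_maps_add[OF g] linear_maps_smult[OF f] linear_maps_smult[OF g]
      by (intro ideal_of_submodule) (auto simp: trace_carrier I.I_l_closed)
    then have "trace_ideal R M \<subseteq> {i \<in> trace_ideal R M. f i = g i}"
      by (rule trace_ideal_least) (auto simp: fg trace_ideal_generator)
    then show "f = g" by (intro linear_maps_eqI[OF f g]) auto
  qed
  have surj: "\<exists>f \<in> ?EI. ?h f = z" if z: "z \<in> ?ED" and central: "\<And>F. F \<in> ?ED \<Longrightarrow> compose ?D z F = compose ?D F z" for z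
  proof -
    have rank_one: "\<alpha> m \<otimes> z \<beta> n = z \<alpha> m \<otimes> \<beta> n"
      if \<alpha>: "\<alpha> \<in> ?D" and \<beta>: "\<beta> \<in> ?D" and m: "m \<in> carrier M" and n: "n \<in> carrier M" for \<alpha> \<beta> m n
    proof -
      \<comment> \<open>Evaluation at \<open>m\<close> followed by scaling \<beta>. Commutation with
        \<open>z\<close>, applied to \<alpha>, reads z(\<alpha>(m) \<beta>) = (z \<alpha>)(m)
        \<beta>; linearity of \<open>z\<close> then gives the identity.\<close>
      let ?F = "\<lambda>\<gamma> \<in> ?D. \<lambda>n \<in> carrier M. \<gamma> m \<otimes> \<beta> n"
      have "?F \<in> ?ED"
        using m \<beta> smult_D add_D
        by (intro linear_mapsI)
           (auto simp: dual_closed l_distr m_assoc cong: restrict_cong)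
      from fun_cong[OF central[OF this], of \<alpha>]
      have "z (\<lambda>n \<in> carrier M. \<alpha> m \<otimes> \<beta> n) = (\<lambda>n \<in> carrier M. z \<alpha> m \<otimes> \<beta> n)"
        using \<alpha> ED_closed[OF z \<alpha>] by (simp add: compose_eq)
      from fun_cong[OF this, of n] show ?thesis
        using ED_smult[OF z \<beta> dual_closed[OF \<alpha> m] n] n by simp
    qed
    \<comment> \<open>These are the possible denominators: \<open>y\<close> times \<open>z\<close>
      is multiplication by a single scalar \<open>c\<close> on the whole dual. By
      \<open>rank_one\<close> each \<alpha>(m) is one, with c = (z \<alpha>)(m). The ideal property
      is what reaches \<open>x\<close>, which is only a sum of such values.\<close>
    let ?K = "{y \<in> carrier R. \<exists>c \<in> carrier R. \<forall>\<beta> \<in> ?D. \<forall>n \<in> carrier M. y \<otimes> z \<beta> n = c \<otimes> \<beta> n}"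
    have z_R: "z \<beta> n \<in> carrier R" if "\<beta> \<in> ?D" "n \<in> carrier M" for \<beta> n
      using dual_closed[OF ED_closed[OF z that(1)] that(2)] .
    have "ideal ?K R"
    proof (rule ideal_of_submodule)
      fix a b assume "a \<in> ?K" "b \<in> ?K"
      then obtain c d where "a \<in> carrier R" "b \<in> carrier R" "c \<in> carrier R" "d \<in> carrier R"
        "\<And>\<beta> n. \<beta> \<in> ?D \<Longrightarrow> n \<in> carrier M \<Longrightarrow> a \<otimes> z \<beta> n = c \<otimes> \<beta> n"
        "\<And>\<beta> n. \<beta> \<in> ?D \<Longrightarrow> n \<in> carrier M \<Longrightarrow> b \<otimes> z \<beta> n = d \<otimes> \<beta> n" by auto
      then show "a \<oplus> b \<in> ?K"
        by (auto intro!: bexI[of _ "c \<oplus> d"] simp: l_distr z_R dual_closed)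
    next
      fix r a assume "r \<in> carrier R" "a \<in> ?K"
      then obtain c where "r \<in> carrier R" "a \<in> carrier R" "c \<in> carrier R"
        "\<And>\<beta> n. \<beta> \<in> ?D \<Longrightarrow> n \<in> carrier M \<Longrightarrow> a \<otimes> z \<beta> n = c \<otimes> \<beta> n" by auto
      then show "r \<otimes> a \<in> ?K"
        by (auto intro!: bexI[of _ "r \<otimes> c"] simp: m_assoc z_R dual_closed)
    qed (auto intro!: bexI[of _ \<zero>] simp: z_R dual_closed)
    then have "trace_ideal R M \<subseteq> ?K"
    proof (rule trace_ideal_least)
      fix \<alpha> m assume "\<alpha> \<in> ?D" "m \<in> carrier M"
      then show "\<alpha> m \<in> ?K"
        using rank_one[of \<alpha> _ m] by (auto simp: dual_closed z_R intro!: bexI[of _ "z \<alpha> m"])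
    qed
    then have "x \<in> ?K" using x(1) by (rule subsetD)
    then obtain c where c: "c \<in> carrier R"
      and xz: "\<And>\<beta> n. \<beta> \<in> ?D \<Longrightarrow> n \<in> carrier M \<Longrightarrow> x \<otimes> z \<beta> n = c \<otimes> \<beta> n" by auto
    \<comment> \<open>For the generator \<beta>(n) the witness is (z \<beta>)(n), again a value of a
      functional. So c/x defines an endomorphism \<open>f\<close> of the trace ideal.\<close>
    have "trace_ideal R M \<subseteq> {j \<in> carrier R. \<exists>r\<in>trace_ideal R M. x \<otimes> r = c \<otimes> j}"
    proof (rule trace_ideal_least[OF ideal_fraction[OF ideal_trace_ideal xR c]])
      fix \<beta> n assume \<beta>: "\<beta> \<in> ?D" and n: "n \<in> carrier M"
      show "\<beta> n \<in> {j \<in> carrier R. \<exists>r\<in>trace_ideal R M. x \<otimes> r = c \<otimes> j}"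
        using xz[OF \<beta> n] trace_ideal_generator[OF ED_closed[OF z \<beta>] n] dual_closed[OF \<beta> n]
        by auto
    qed
    then obtain f where f: "f \<in> ?EI" and xf: "\<And>j. j \<in> trace_ideal R M \<Longrightarrow> x \<otimes> f j = c \<otimes> j"
      using fraction_linear_map[OF ideal_trace_ideal x(2) c, of "trace_module R M"]
      by (auto simp: subset_iff)
    \<comment> \<open>Both sides at \<open>n\<close> become c \<beta>(n) after multiplication by
      \<open>x\<close>.\<close>
    have "compose (carrier M) f \<beta> = z \<beta>" if \<beta>: "\<beta> \<in> ?D" for \<beta>
    proof (rule linear_maps_eqI[OF f\<alpha>[OF f \<beta>] ED_closed[OF z \<beta>]])
      fix n assume n: "n \<in> carrier M"
      then show "compose (carrier M) f \<beta> n = z \<beta> n"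
        using xf[OF trace_ideal_generator[OF \<beta> n]] xz[OF \<beta> n] z_R[OF \<beta> n] dual_closed[OF f\<alpha>[OF f \<beta>] n]
        by - (rule nonzerodivisor_cancel[OF x(2)], auto simp: compose_eq)
    qed
    then have "?h f = z"
      by (intro linear_maps_eqI[OF h_ED[OF f] z]) auto
    with f show ?thesis by blast
  qed
  have "bij_betw ?h ?EI ?C"
    unfolding bij_betw_def
  proof
    show "?h ` ?EI = ?C"
    proof
      show "?h ` ?EI \<subseteq> ?C" using h_center by (intro image_subsetI)
      show "?C \<subseteq> ?h ` ?EI"
      proof
        fix z assume "z \<in> ?C"
        then obtain f where "f \<in> ?EI" "?h f = z" using surj[of z] by auto
        then show "z \<in> ?h ` ?EI" by (intro image_eqI[of z ?h f]) (rule sym)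
      qed
    qed
  qed (rule inj)
  moreover have "?h \<in> ring_hom (End_algebra R (trace_module R M))
      (ring_center (End_algebra R (dual_module R M)))"
  proof (rule ring_hom_memI)
    fix f assume "f \<in> carrier (End_algebra R (trace_module R M))"
    then show "?h f \<in> carrier (ring_center (End_algebra R (dual_module R M)))"
      using h_center[of f] by simp
  next
    fix f g assume "f \<in> carrier (End_algebra R (trace_module R M))"
      "g \<in> carrier (End_algebra R (trace_module R M))"
    then have f: "f \<in> ?EI" and g: "g \<in> ?EI" by auto
    show "?h (f \<otimes>\<^bsub>End_algebra R (trace_module R M)\<^esub> g) =
        ?h f \<otimes>\<^bsub>ring_center (End_algebra R (dual_module R M))\<^esub> ?h g"
      using f\<alpha>[OF g] trace_ideal_generator
      by (auto simp: compose_def cong: restrict_cong)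
    show "?h (f \<oplus>\<^bsub>End_algebra R (trace_module R M)\<^esub> g) =
        ?h f \<oplus>\<^bsub>ring_center (End_algebra R (dual_module R M))\<^esub> ?h g"
      using trace_ideal_generator by (auto simp: compose_def cong: restrict_cong)
  next
    \<comment> \<open>The identity of the trace ideal is \<open>undefined\<close> elsewhere; it
      fixes \<alpha> because all values of \<alpha> lie in the trace ideal.\<close>
    have "compose (carrier M) (\<lambda>i \<in> trace_ideal R M. i) \<alpha> = \<alpha>" if \<alpha>: "\<alpha> \<in> ?D" for \<alpha>
      using linear_maps_extensional[OF \<alpha>] trace_ideal_generator[OF \<alpha>]
      by (auto simp: compose_def fun_eq_iff extensional_def)
    then show "?h \<one>\<^bsub>End_algebra R (trace_module R M)\<^esub> =
        \<one>\<^bsub>ring_center (End_algebra R (dual_module R M))\<^esub>"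
      by (auto cong: restrict_cong)
  qed
  moreover have "?h (r \<odot>\<^bsub>End_algebra R (trace_module R M)\<^esub> f) =
      r \<odot>\<^bsub>ring_center (End_algebra R (dual_module R M))\<^esub> ?h f" for r f
    using trace_ideal_generator by (auto simp: compose_def cong: restrict_cong)
  ultimately have "?h \<in> alg_iso R (End_algebra R (trace_module R M))
      (ring_center (End_algebra R (dual_module R M)))"
    by (simp add: alg_iso_def ring_iso_def)
  then show ?thesis unfolding is_alg_iso_def by blast
qed

end

theorem corollary3p23:
  fixes R :: "('a, 'm) ring_scheme" and M :: "('a, 'b, 'n) module_scheme"
  assumes "cring R" and "noetherian_ring R"
    and "module R M" and "fin_gen_module R M"
    and "0 < grade R (trace_ideal R M)"
  shows "is_alg_iso R (End_algebra R (trace_module R (dual_module R M)))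
                      (End_algebra R (trace_module R M)) \<and>
         is_alg_iso R (End_algebra R (trace_module R M))
                      (ring_center (End_algebra R (dual_module R M)))"
proof -
  interpret module R M by fact
  interpret I: ideal "trace_ideal R M" R by (rule ideal_trace_ideal)
  obtain x where "x \<in> trace_ideal R M" "nonzerodivisor R x"
    using nonzerodivisor_of_grade_pos[OF I.a_subset I.zero_closed assms(5)] by blast
  then show ?thesis
    using End_trace_dual_iso End_trace_center_iso by blast
qed

end
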